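(* Let $\zeta$ be an admissible substitution on a finite alphabet $\mathcal{A}$, with recognizability index $K$, and let $\mathbf{u}$ be a fixed point of $\zeta$. Then $\mathbf{u}\in\mathcal{P}$; that is, there exist $r\geq 1$ and a finite coloring $c:\mathcal{L}(\mathbf{u})\to\{1,\ldots,r\}$ such that for each factorization $\mathbf{u}=\mathbf{u}_1\mathbf{u}_2\mathbf{u}_3\ldots$ into infinitely many nonempty finite words there exist $i,j$ with $c(\mathbf{u}_i)\neq c(\mathbf{u}_j)$.
   Context: Words. $\mathcal{A}^*$ is the monoid of finite words over $\mathcal{A}$ under concatenation (with the empty word as identity), and $|\mathbf{w}|$ is the length of $\mathbf{w}$. For an infinite word $\mathbf{u}=\alpha_1\alpha_2\alpha_3\ldots$ over $\mathcal{A}$, $\mathbf{u}_{[i,j]}=\alpha_i\alpha_{i+1}\ldots\alpha_j$ for $1\le i\le j$, $\mathbf{u}_{[1,0]}$ is the empty word, and $\mathcal{L}(\mathbf{u})$ is the set of all nonempty finite factors of $\mathbf{u}$. $\mathcal{P}$ denotes the set of all infinite words $\mathbf{u}$ over a finite alphabet admitting a finite coloring $c$ of $\mathcal{L}(\mathbf{u})$ such that no factorization $\mathbf{u}=\mathbf{u}_1\mathbf{u}_2\mathbf{u}_3\ldots$ has all $c(\mathbf{u}_i)$ equal. Substitutions. A substitution $\zeta$ of $\mathcal{A}$ is a map $\zeta:\mathcal{A}\to\mathcal{A}^*$, extended to a morphism of $\mathcal{A}^*$ and to infinite words by concatenation. It is primitive if there is $n>0$ such that for all $\alpha,\beta\in\mathcal{A}$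 the letter $\beta$ occurs in $\zeta^n(\alpha)$. Let $\mathcal{L}_\zeta$ be the set of all factors of the words $\zeta^n(\alpha)$, $n\ge 0$, $\alpha\in\mathcal{A}$, and $X_\zeta=\{\mathbf{v}\in\mathcal{A}^{\mathbb{N}}:\mathcal{L}(\mathbf{v})\subseteq\mathcal{L}_\zeta\}$. A fixed point of $\zeta$ is an infinite word $\mathbf{u}\in X_\zeta$ with $\zeta(\mathbf{u})=\mathbf{u}$. It is assumed throughout that some letter $\alpha$ is the first letter of $\zeta(\alpha)$. Recognizability (with respect to the fixed point $\mathbf{u}$). The $1$-cutting bars of $\zeta$ are the elements of $E_1=\{1\}\cup\{|\zeta(\mathbf{u}_{[1,p]})|+1: p\ge 1\}$. An integer interval $I=[i^-,i^+]$ with $1\le i^-\le i^+$ is $1$-fitted if $i^-$ and $i^++1$ are $1$-cutting bars; in this case $p_I,q_I\geq 0$ are defined by $i^-=|\zeta(\mathbf{u}_{[1,p_I]})|+1$ and $i^++1=|\zeta(\mathbf{u}_{[1,q_I]})|+1$, so that $\mathbf{u}_I=\zeta(\mathbf{u}_{[p_I+1,q_I]})$. The substitution $\zeta$ is strongly recognizable if there exists an integer $K\ge 0$ such that: whenever $I$ is a $1$-fitted interval with $|I|>K$ (where $|I|$ is the number of integers in $I$) and $J$ is an integer interval with $\mathbf{u}_I=\mathbf{u}_J$, then $J$ is also $1$-fitted and $\mathbf{u}_{[p_I+1,q_I]}=\mathbf{u}_{[p_J+1,q_J]}$. The smallest such $K$ is the recognizability index of $\zeta$. The substitution $\zeta$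 is admissible if it is primitive and strongly recognizable. *)

theory Defs
  imports "HOL-Library.FuncSet" "HOL-Library.Stream" "HOL-Library.Sublist"
begin

(* The finite alphabet is a type of class finite; infinite words are streams and finite words are
   lists. Positions in an infinite word are counted from 1, whereas snth counts from 0. *)

definition factor :: "'a stream \<Rightarrow> nat \<Rightarrow> nat \<Rightarrow> 'a list" where
  "factor u i j = stake (j + 1 - i) (sdrop (i - 1) u)"

definition language :: "'a stream \<Rightarrow> 'a list set" where
  "language u = {factor u i j | i j. 1 \<le> i \<and> i \<le> j}"

definition factorization :: "'a stream \<Rightarrow> 'a list stream \<Rightarrow> bool" where
  "factorization u us \<longleftrightarrow> (\<forall>w \<in> sset us. w \<noteq> []) \<and> u = flat us"

definition \<P> :: "'a::finite stream set" where
  "\<P> = {u. \<exists>r::nat. \<exists>c :: 'a list \<Rightarrow> nat. r \<ge> 1 \<and> c \<in> language u \<rightarrow> {1..r} \<and>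
        (\<forall>us. factorization u us \<longrightarrow> (\<exists>i j. c (us !! i) \<noteq> c (us !! j)))}"

type_synonym 'a substitution = "'a \<Rightarrow> 'a list"

definition apply_subst :: "'a substitution \<Rightarrow> 'a list \<Rightarrow> 'a list" where
  "apply_subst \<zeta> w = concat (map \<zeta> w)"

(* Meaningful only if no letter is mapped to the empty word (flat is unspecified on streams
   containing empty lists); every primitive substitution has this property. *)
definition apply_subst_inf :: "'a substitution \<Rightarrow> 'a stream \<Rightarrow> 'a stream" where
  "apply_subst_inf \<zeta> u = flat (smap \<zeta> u)"

definition primitive :: "'a::finite substitution \<Rightarrow> bool" where
  "primitive \<zeta> \<longleftrightarrow> (\<exists>n>0. \<forall>\<alpha> \<beta>. \<beta> \<in> set ((apply_subst \<zeta> ^^ n) [\<alpha>]))"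

definition subst_language :: "'a substitution \<Rightarrow> 'a list set" where
  "subst_language \<zeta> = {w. \<exists>n \<alpha>. sublist w ((apply_subst \<zeta> ^^ n) [\<alpha>])}"

definition subst_space :: "'a substitution \<Rightarrow> 'a stream set" where
  "subst_space \<zeta> = {v. language v \<subseteq> subst_language \<zeta>}"

definition fixed_point :: "'a substitution \<Rightarrow> 'a stream \<Rightarrow> bool" where
  "fixed_point \<zeta> u \<longleftrightarrow> u \<in> subst_space \<zeta> \<and> apply_subst_inf \<zeta> u = u"

definition cutting_bars :: "'a substitution \<Rightarrow> 'a stream \<Rightarrow> nat set" where
  "cutting_bars \<zeta> u = {1} \<union> {length (apply_subst \<zeta> (factor u 1 p)) + 1 | p. p \<ge> 1}"

(* fitted \<zeta> u i j says that the interval [i,j] is 1-fitted. *)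
definition fitted :: "'a substitution \<Rightarrow> 'a stream \<Rightarrow> nat \<Rightarrow> nat \<Rightarrow> bool" where
  "fitted \<zeta> u i j \<longleftrightarrow>
     1 \<le> i \<and> i \<le> j \<and> i \<in> cutting_bars \<zeta> u \<and> j + 1 \<in> cutting_bars \<zeta> u"

(* For a 1-fitted interval I = [i,j], the numbers p_I and q_I are the indices of the cutting bars
   i and j + 1. The index is unique if no letter is mapped to the empty word. *)
definition bar_index :: "'a substitution \<Rightarrow> 'a stream \<Rightarrow> nat \<Rightarrow> nat" where
  "bar_index \<zeta> u k = (THE p. k = length (apply_subst \<zeta> (factor u 1 p)) + 1)"

(* The desubstituted word u_[p_I + 1, q_I] of a 1-fitted interval I = [i,j]. *)
definition desubst :: "'a substitution \<Rightarrow> 'a stream \<Rightarrow> nat \<Rightarrow> nat \<Rightarrow> 'a list" where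
  "desubst \<zeta> u i j = factor u (bar_index \<zeta> u i + 1) (bar_index \<zeta> u (j + 1))"

definition recognizable_from :: "'a substitution \<Rightarrow> 'a stream \<Rightarrow> nat \<Rightarrow> bool" where
  "recognizable_from \<zeta> u K \<longleftrightarrow>
     (\<forall>i j k l. fitted \<zeta> u i j \<and> card {i..j} > K \<and> 1 \<le> k \<and> k \<le> l \<and>
        factor u i j = factor u k l \<longrightarrow>
        fitted \<zeta> u k l \<and> desubst \<zeta> u i j = desubst \<zeta> u k l)"

definition strongly_recognizable :: "'a substitution \<Rightarrow> 'a stream \<Rightarrow> bool" where
  "strongly_recognizable \<zeta> u \<longleftrightarrow> (\<exists>K. recognizable_from \<zeta> u K)"

definition recognizability_index :: "'a substitution \<Rightarrow> 'a stream \<Rightarrow> nat" where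
  "recognizability_index \<zeta> u = (LEAST K. recognizable_from \<zeta> u K)"

(* Recognizability, hence admissibility, refers to the given fixed point u. *)
definition admissible :: "'a::finite substitution \<Rightarrow> 'a stream \<Rightarrow> bool" where
  "admissible \<zeta> u \<longleftrightarrow> primitive \<zeta> \<and> strongly_recognizable \<zeta> u"

end

theory Submission
  imports Defs
begin

text \<open>Only the aperiodicity of \<^term>\<open>u\<close> matters. Fix a linear order on the letters and colour a prefix
  of \<^term>\<open>u\<close> by whether \<^term>\<open>u\<close> is lexicographically smaller or larger than the tail that remains
  after deleting this prefix; all other words get a third colour. In a monochromatic factorization
  every factor is then a prefix of \<^term>\<open>u\<close>, and all tails at the cut points lie strictly on the
  same side of \<^term>\<open>u\<close>. The position of the first difference between \<^term>\<open>u\<close> and these tails drops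
  at each cut, which is absurd.

  A minimal period \<^term>\<open>m\<close> of \<^term>\<open>u\<close> is ruled out by desubstitution: recognizability makes
  \<^term>\<open>m + 1\<close> a cutting bar whose index \<^term>\<open>p\<close> is again a period, so \<^term>\<open>p = m\<close> and the first
  letter is mapped to itself, which primitivity forbids.\<close>

section \<open>Aperiodic words\<close>

lemma snth_ext:
  assumes "\<And>i. u !! i = v !! i"
  shows "u = v"
proof -
  have "(!!) u = (!!) v" using assms by (rule ext)
  then show ?thesis using stream_smap_nats[of u] stream_smap_nats[of v] by simp
qed

text \<open>The deciding position \<open>n\<close> is an explicit argument because the later descent
  runs on it. With \<open>R\<close> as a parameter, an order and its reverse are treated at
  once.\<close>

definition lex_at :: "('a \<Rightarrow> 'a \<Rightarrow> bool) \<Rightarrow> 'a stream \<Rightarrow> 'a stream \<Rightarrow> nat \<Rightarrow> bool" where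
  "lex_at R u v n \<longleftrightarrow> (\<forall>i<n. u !! i = v !! i) \<and> R (u !! n) (v !! n)"

lemma lex_at_trans:
  assumes "transp R" "lex_at R u v m" "lex_at R v w n"
  shows "lex_at R u w (min m n)"
proof (cases m n rule: linorder_cases)
  case equal
  then show ?thesis using assms by (auto simp: lex_at_def dest: transpD)
qed (use assms in \<open>auto simp: lex_at_def min_def\<close>)

text \<open>Irreflexivity keeps the deciding position out of the common prefix \<open>w\<close>, so
  the comparison survives the removal of \<open>w\<close>.\<close>

lemma lex_at_shift:
  assumes "irreflp R" "lex_at R (w @- u) (w @- v) n"
  shows "length w \<le> n" "lex_at R u v (n - length w)"
proof -
  show le: "length w \<le> n"
    using assms by (auto simp: lex_at_def shift_snth irreflp_def not_le intro: ccontr)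
  have "u !! i = v !! i" if "i < n - length w" for i
  proof -
    have "length w + i < n" using that by simp
    then have "(w @- u) !! (length w + i) = (w @- v) !! (length w + i)"
      using assms(2) unfolding lex_at_def by blast
    then show ?thesis by (simp add: shift_snth)
  qed
  then show "lex_at R u v (n - length w)"
    using assms(2) le by (auto simp: lex_at_def shift_snth)
qed

lemma lex_at_exists:
  fixes f :: "'a \<Rightarrow> 'b::linorder"
  assumes "u \<noteq> v" "inj f"
  shows "(\<exists>n. lex_at (\<lambda>x y. f x < f y) u v n) \<or> (\<exists>n. lex_at (\<lambda>x y. f y < f x) u v n)"
proof -
  have "\<exists>n. u !! n \<noteq> v !! n"
    using assms(1) snth_ext by blast
  then obtain n where n: "u !! n \<noteq> v !! n" "\<And>i. i < n \<Longrightarrow> u !! i = v !! i"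
    using exists_least_iff[of "\<lambda>n. u !! n \<noteq> v !! n"] by blast
  then have "f (u !! n) \<noteq> f (v !! n)"
    using assms(2) by (simp add: inj_eq)
  then show ?thesis
    unfolding lex_at_def using n(2) by (meson linorder_neqE)
qed

text \<open>Descent on \<open>d\<close>: removing the common prefix \<open>w\<close> compares
  \<open>sdrop (length w) u\<close> with the remaining factors at \<open>d - length w\<close>. Since
  \<open>u\<close> precedes \<open>sdrop (length w) u\<close>, it also precedes the remaining word,
  at a position below \<open>d\<close>. Leaving \<open>us\<close> general lets the induction pass to
  its tail.\<close>

lemma not_lex_at_flat_prefixes:
  assumes "irreflp R" "transp R"
    and "\<forall>w\<in>sset us. w \<noteq> [] \<and> w = stake (length w) u \<and>
           (\<exists>n. lex_at R u (sdrop (length w) u) n)"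
  shows "\<not> lex_at R u (flat us) d"
  using assms(3)
proof (induction d arbitrary: us rule: less_induct)
  case (less d)
  show ?case
  proof
    assume d: "lex_at R u (flat us) d"
    obtain w us' where us: "us = w ## us'" by (cases us)
    obtain n where w: "w \<noteq> []" "w = stake (length w) u"
      and n: "lex_at R u (sdrop (length w) u) n"
      using less.prems us by auto
    have "lex_at R (w @- sdrop (length w) u) (w @- flat us') d"
      using d w us by (metis flat_Stream stake_sdrop)
    note shifted = lex_at_shift[OF assms(1) this]
    have "lex_at R u (flat us') (min n (d - length w))"
      by (rule lex_at_trans[OF assms(2) n shifted(2)])
    moreover have "min n (d - length w) < d"
      using shifted(1) w(1) by (cases w) auto
    moreover have "\<forall>w\<in>sset us'. w \<noteq> [] \<and> w = stake (length w) u \<and>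
        (\<exists>n. lex_at R u (sdrop (length w) u) n)"
      using less.prems us by simp
    ultimately show False
      using less.IH by blast
  qed
qed

lemma no_lex_prefix_factorization:
  assumes "irreflp R" "transp R" "factorization u us"
  shows "\<exists>w\<in>sset us. \<not> (w = stake (length w) u \<and> (\<exists>n. lex_at R u (sdrop (length w) u) n))"
proof (rule ccontr)
  assume "\<not> ?thesis"
  then have *: "\<forall>w\<in>sset us. w \<noteq> [] \<and> w = stake (length w) u \<and>
      (\<exists>n. lex_at R u (sdrop (length w) u) n)"
    using assms(3) by (auto simp: factorization_def)
  \<comment> \<open>The descent has to start after the first factor, since \<open>flat us\<close> is
    \<open>u\<close> itself.\<close>
  obtain w us' where us: "us = w ## us'" by (cases us)
  have "u = w @- flat us'"
    using assms(3) us by (auto simp: factorization_def)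
  then have "sdrop (length w) u = flat us'"
    by (simp add: sdrop_shift)
  then obtain n where "lex_at R u (flat us') n"
    using * us by auto
  moreover have "\<not> lex_at R u (flat us') n"
    by (rule not_lex_at_flat_prefixes[OF assms(1,2)]) (use * us in simp)
  ultimately show False by blast
qed

theorem aperiodic_in_P:
  fixes u :: "'a::finite stream"
  assumes aper: "\<And>m. m > 0 \<Longrightarrow> sdrop m u \<noteq> u"
  shows "u \<in> \<P>"
proof -
  obtain f :: "'a \<Rightarrow> nat" where f: "inj f"
    using finite_imp_inj_to_nat_seg[OF finite_UNIV] by blast
  define less where "less = (\<lambda>x y. f x < f y)"
  define greater where "greater = (\<lambda>x y. f y < f x)"
  have order: "irreflp less" "transp less" "irreflp greater" "transp greater"
    by (auto simp: less_def greater_def irreflp_def transp_def)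
  define pre where "pre R w \<longleftrightarrow> w = stake (length w) u \<and> (\<exists>n. lex_at R u (sdrop (length w) u) n)"
    for R and w :: "'a list"
  define c :: "'a list \<Rightarrow> nat" where
    "c w = (if pre less w then 2 else if pre greater w then 3 else 1)" for w
  have "\<exists>i j. c (us !! i) \<noteq> c (us !! j)" if us: "factorization u us" for us
  proof (rule ccontr)
    assume "\<not> ?thesis"
    then have same: "c (us !! i) = c (us !! j)" for i j by blast
    have mono: "c w = c (shd us)" if "w \<in> sset us" for w
      proof -
      obtain i where "w = us !! i" using \<open>w \<in> sset us\<close> by (auto simp: sset_range)
      then have "c w = c (us !! 0)" using same by blast
      then show ?thesis by simp
    qed
    have shd: "shd us \<in> sset us" by (simp add: shd_sset)
    have ne: "shd us \<noteq> []"
      using us shd unfolding factorization_def by blast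
    have u: "u = shd us @- flat (stl us)"
      using us flat_Stream[OF ne, of "stl us"] by (simp add: factorization_def)
    \<comment> \<open>The first factor excludes colour 1: it is a prefix of \<open>u\<close>, and by
      aperiodicity the tail after it differs from \<open>u\<close>.\<close>
    have "stake (length (shd us)) u = shd us"
      by (subst u) (simp add: stake_shift)
    moreover have "u \<noteq> sdrop (length (shd us)) u"
      using aper[of "length (shd us)"] ne by auto
    ultimately have "pre less (shd us) \<or> pre greater (shd us)"
      unfolding pre_def less_def greater_def using lex_at_exists[OF _ f] by metis
    then consider "\<forall>w\<in>sset us. c w = 2" | "\<forall>w\<in>sset us. c w = 3"
      using mono by (metis c_def)
    then have "(\<forall>w\<in>sset us. pre less w) \<or> (\<forall>w\<in>sset us. pre greater w)"
    proof cases
      case 1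
      then have "\<forall>w\<in>sset us. pre less w" by (auto simp: c_def split: if_splits)
      then show ?thesis ..
    next
      case 2
      then have "\<forall>w\<in>sset us. pre greater w" by (auto simp: c_def split: if_splits)
      then show ?thesis ..
    qed
    then show False
      using no_lex_prefix_factorization[OF order(1,2) us]
        no_lex_prefix_factorization[OF order(3,4) us] unfolding pre_def by blast
  qed
  moreover have "c \<in> language u \<rightarrow> {1..3}"
    by (auto simp: c_def)
  ultimately show ?thesis
    unfolding \<P>_def by (intro CollectI exI[of _ 3] exI[of _ c]) auto
qed

section \<open>Recognizability and periods\<close>

text \<open>Every positive power of \<open>\<zeta>\<close> would erase \<open>\<alpha>\<close> as
  well, but some such power of \<open>\<alpha>\<close> contains \<open>\<alpha>\<close>.\<close>

lemma primitive_nonerasing: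
  assumes "primitive \<zeta>"
  shows "\<zeta> \<alpha> \<noteq> []"
proof
  assume "\<zeta> \<alpha> = []"
  obtain n where n: "n > 0" "\<alpha> \<in> set ((apply_subst \<zeta> ^^ n) [\<alpha>])"
    using assms unfolding primitive_def by blast
  obtain k where "n = Suc k" using n(1) by (cases n) auto
  have "(apply_subst \<zeta> ^^ k) [] = []" for k
    by (induction k) (auto simp: apply_subst_def)
  then show False
    using n(2) \<open>n = Suc k\<close> \<open>\<zeta> \<alpha> = []\<close> by (simp add: funpow_swap1 apply_subst_def)
qed

text \<open>Letters fixed by a primitive substitution only occur for the identity on one letter, whose
  language has no word of length two.\<close>
lemma primitive_fixed_letter:
  assumes "primitive \<zeta>" "\<zeta> \<alpha> = [\<alpha>]"
  shows "subst_space \<zeta> = {}"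
proof -
  have pow: "(apply_subst \<zeta> ^^ n) [\<alpha>] = [\<alpha>]" for n
    using assms(2) by (induction n) (auto simp: apply_subst_def)
  then have single: "\<beta> = \<alpha>" for \<beta>
    using assms(1) unfolding primitive_def by (metis pow list.set(1,2) singletonD)
  have "length w \<le> 1" if w: "w \<in> subst_language \<zeta>" for w
  proof -
    obtain n \<beta> where "sublist w ((apply_subst \<zeta> ^^ n) [\<beta>])"
      using w unfolding subst_language_def by auto
    then have "sublist w [\<alpha>]" by (simp add: pow single[of \<beta>])
    then show ?thesis using sublist_length_le by fastforce
  qed
  moreover have "factor v 1 2 \<in> language v" "length (factor v 1 2) = 2" for v :: "'a stream"
    unfolding language_def by (fastforce, simp add: factor_def)
  ultimately show ?thesis
    unfolding subst_space_def by fastforce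
qed

text \<open>One less than the cutting bar of index \<open>p\<close>. Index 0 yields the bar 1, so
  that all bars have one form.\<close>

definition image_length :: "'a substitution \<Rightarrow> 'a stream \<Rightarrow> nat \<Rightarrow> nat" where
  "image_length \<zeta> u p = length (apply_subst \<zeta> (stake p u))"

lemma image_length_0 [simp]: "image_length \<zeta> u 0 = 0"
  by (simp add: image_length_def apply_subst_def)

lemma image_length_Suc:
  "image_length \<zeta> u (Suc p) = image_length \<zeta> u p + length (\<zeta> (u !! p))"
  by (simp add: image_length_def apply_subst_def stake_Suc del: stake.simps)

lemma cutting_bars_eq: "cutting_bars \<zeta> u = range (\<lambda>p. image_length \<zeta> u p + 1)"
proof -
  have "cutting_bars \<zeta> u = insert (image_length \<zeta> u 0 + 1) ((\<lambda>p. image_length \<zeta> u p + 1) ` {1..})"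
    unfolding cutting_bars_def factor_def by (auto simp: image_length_def apply_subst_def)
  also have "\<dots> = (\<lambda>p. image_length \<zeta> u p + 1) ` insert 0 {1..}"
    by simp
  also have "insert 0 {1..} = (UNIV :: nat set)"
    by auto
  finally show ?thesis .
qed

context
  fixes \<zeta> :: "'a substitution" and u :: "'a stream"
  assumes nonerasing: "\<And>\<alpha>. \<zeta> \<alpha> \<noteq> []"
begin

lemma strict_mono_image_length: "strict_mono (image_length \<zeta> u)"
  using nonerasing by (simp add: strict_mono_Suc_iff image_length_Suc)

lemma bar_index_image_length: "bar_index \<zeta> u (image_length \<zeta> u p + 1) = p"
proof -
  have "image_length \<zeta> u p + 1 = length (apply_subst \<zeta> (factor u 1 q)) + 1 \<longleftrightarrow> q = p" for q
    using strict_mono_eq[OF strict_mono_image_length, of p q]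
    by (auto simp: factor_def image_length_def)
  then show ?thesis unfolding bar_index_def by simp
qed

text \<open>Each of the \<open>m\<close> letters contributes at least 1 to a total of
  \<open>m\<close>, so the first one contributes exactly 1.\<close>

lemma image_length_eq_self:
  assumes "image_length \<zeta> u m = m" "m > 0"
  shows "length (\<zeta> (shd u)) = 1"
proof -
  have "length (\<zeta> (shd u)) + k \<le> image_length \<zeta> u (Suc k)" for k
  proof (induction k)
    case (Suc k)
    have "length (\<zeta> (u !! Suc k)) > 0" using nonerasing by simp
    then show ?case using Suc image_length_Suc[of \<zeta> u "Suc k"] by linarith
  qed (simp add: image_length_Suc)
  from this[of "m - 1"] have "length (\<zeta> (shd u)) \<le> 1" using assms by simp
  moreover have "length (\<zeta> (shd u)) > 0" using nonerasing by simp
  ultimately show ?thesis by linarith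
qed

lemma recognizable_period_desubst:
  assumes rec: "recognizable_from \<zeta> u K" and per: "sdrop m u = u"
  shows "\<exists>p. image_length \<zeta> u p = m \<and> sdrop p u = u"
proof -
  have desubst: "\<exists>p. image_length \<zeta> u p = m \<and> stake q (sdrop p u) = stake q u" if q: "q > K" for q
  proof -
    let ?L = "image_length \<zeta> u"
    have "q \<le> ?L q" by (rule strict_mono_imp_increasing[OF strict_mono_image_length])
    then have big: "?L q > K" using q by simp
    have fit: "fitted \<zeta> u 1 (?L q)"
      using big image_length_0[of \<zeta> u] unfolding fitted_def cutting_bars_eq
      by (auto intro: image_eqI[of _ _ 0])
    \<comment> \<open>The period gives the image of the prefix of length \<open>q\<close> a second
      occurrence, starting at \<open>m + 1\<close>.\<close>
    have eq: "factor u 1 (?L q) = factor u (m + 1) (?L q + m)"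
      using per by (simp add: factor_def)
    have "1 \<le> m + 1" "m + 1 \<le> ?L q + m" "card {1..?L q} > K"
      using big by simp_all
    then have "fitted \<zeta> u (m + 1) (?L q + m)"
      and des: "desubst \<zeta> u 1 (?L q) = desubst \<zeta> u (m + 1) (?L q + m)"
      using rec[unfolded recognizable_from_def, rule_format, of 1 "?L q" "m + 1" "?L q + m"] fit eq
      by blast+
    then obtain p p' where p: "m = ?L p" and p': "?L q + m = ?L p'"
      unfolding fitted_def cutting_bars_eq by auto
    have idx: "bar_index \<zeta> u 1 = 0" "bar_index \<zeta> u (?L q + 1) = q"
      "bar_index \<zeta> u (m + 1) = p" "bar_index \<zeta> u (?L q + m + 1) = p'"
      using bar_index_image_length[of 0] bar_index_image_length[of q]
        bar_index_image_length[of p] bar_index_image_length[of p'] p p' by simp_all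
    have *: "stake q u = stake (p' - p) (sdrop p u)"
      using des unfolding desubst_def idx by (simp add: factor_def)
    then have "p' - p = q" by (metis length_stake)
    then show ?thesis using * p by auto
  qed
  obtain p where p: "image_length \<zeta> u p = m"
    using desubst[of "Suc K"] by auto
  \<comment> \<open>The index \<open>p\<close> is determined by \<open>m\<close> and hence the same
    for all \<open>q\<close>, so arbitrarily long prefixes of \<open>sdrop p u\<close> and
    \<open>u\<close> agree.\<close>
  have "sdrop p u !! i = u !! i" for i
  proof -
    obtain p' where "image_length \<zeta> u p' = m"
      and st: "stake (Suc (K + i)) (sdrop p' u) = stake (Suc (K + i)) u"
      using desubst[of "Suc (K + i)"] by auto
    then have "p' = p" using p strict_mono_eq[OF strict_mono_image_length] by metis
    then have "stake (Suc (K + i)) (sdrop p u) ! i = stake (Suc (K + i)) u ! i"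
      using st by simp
    then show ?thesis by (simp del: stake.simps)
  qed
  then have "sdrop p u = u" by (rule snth_ext)
  then show ?thesis using p by blast
qed

end

lemma admissible_aperiodic:
  assumes fixed: "fixed_point \<zeta> u" and adm: "admissible \<zeta> u" and "m > 0"
  shows "sdrop m u \<noteq> u"
proof
  assume "sdrop m u = u"
  have prim: "primitive \<zeta>" using adm by (simp add: admissible_def)
  have ne: "\<zeta> \<alpha> \<noteq> []" for \<alpha>
    by (rule primitive_nonerasing[OF prim])
  obtain K where K: "recognizable_from \<zeta> u K"
    using adm by (auto simp: admissible_def strongly_recognizable_def)
  define P where "P k \<longleftrightarrow> k > 0 \<and> sdrop k u = u" for k
  have "P m" using \<open>sdrop m u = u\<close> \<open>m > 0\<close> by (simp add: P_def)
  then obtain k where k: "P k" "\<And>j. j < k \<Longrightarrow> \<not> P j"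
    using exists_least_iff[of P] by blast
  obtain p where p: "image_length \<zeta> u p = k" "sdrop p u = u"
    using recognizable_period_desubst[OF ne K] k(1) P_def by metis
  have "p \<le> k"
    unfolding p(1)[symmetric]
    by (intro strict_mono_imp_increasing strict_mono_image_length ne)
  \<comment> \<open>Here \<open>p = 0\<close> would force \<open>k = 0\<close>.\<close>
  moreover have "P p" using p k(1) by (cases p) (auto simp: P_def)
  ultimately have "p = k" using k(2) by (metis le_neq_implies_less)
  then have "length (\<zeta> (shd u)) = 1"
    using p(1) k(1) by (intro image_length_eq_self ne) (auto simp: P_def)
  then obtain x where x: "\<zeta> (shd u) = [x]" by (auto simp: length_Suc_conv)
  \<comment> \<open>The fixed point starts with the image of its own first letter, so
    \<open>x\<close> is that letter.\<close>
  have "flat (smap \<zeta> u) = u"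
    using fixed by (simp add: fixed_point_def apply_subst_inf_def)
  moreover have "shd (flat (smap \<zeta> u)) = x"
    using x by simp
  ultimately have "\<zeta> (shd u) = [shd u]" using x by simp
  from primitive_fixed_letter[OF prim this] show False
    using fixed by (simp add: fixed_point_def)
qed

theorem theorem4:
  fixes \<zeta> :: "'a::finite substitution" and u :: "'a stream" and K :: nat
  assumes "\<exists>\<alpha> w. \<zeta> \<alpha> = \<alpha> # w"
    and "fixed_point \<zeta> u"
    and "admissible \<zeta> u"
    and "K = recognizability_index \<zeta> u"
  shows "u \<in> \<P>"
  using aperiodic_in_P admissible_aperiodic[OF assms(2,3)] by blast

end
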